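(* Let $q^{(1)},\dots,q^{(P)}\in\mathbb{R}$ be given (desired net charges), and for $k=1,\dots,P$ let $\boldsymbol{\alpha}_0^{(k)} = \frac{q^{(k)}}{N}\mathbf{1}_N\in\mathbb{R}^N$. Let $\boldsymbol{\alpha}=\{\boldsymbol{\alpha}^{(k)}\}_{k=1}^P\in\mathbb{R}^{PN}$, with blocks $\boldsymbol{\alpha}^{(k)}\in\mathbb{R}^N$, solve (exactly) the formally overdetermined linear system with block rows $$\left[\mathbf{S}^{(kk)}(\mathbf{I}-\mathbf{L})+\mathbf{L}_r\right]\boldsymbol{\alpha}^{(k)}+\sum_{k'\neq k}\mathbf{S}^{(kk')}(\mathbf{I}-\mathbf{L})\boldsymbol{\alpha}^{(k')} = -\mathbf{u}_0^{(k)},\qquad k=1,\dots,P,$$ where the right-hand side has block entries $$\mathbf{u}_0^{(k)}=\sum_{k'=1}^P\mathbf{S}^{(kk')}\boldsymbol{\alpha}_0^{(k')},\qquad k=1,\dots,P.$$ Let $u$ be the potential $$u(\mathbf{x})=\sum_{k=1}^P\sum_{j=1}^N\beta_j^{(k)}\,G(\mathbf{x},\mathbf{y}_j^{(k)}),\qquad \boldsymbol{\beta}^{(k)} := (\mathbf{I}-\mathbf{L})\boldsymbol{\alpha}^{(k)}+\boldsymbol{\alpha}_0^{(k)}.$$ Then: 1. $u$ is harmonic in $\mathbb{R}^3\setminus\overline{\Omega}$; 2. $u$ is constant on the collocation nodes of each body, i.e. for each $k$ there is a constant $\phi^{(k)}\in\mathbb{R}$ with $u(\mathbf{x}_i^{(k)})=\phi^{(k)}$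 for all $i=1,\dots,M$; 3. $u$ has the desired net charges, i.e. $\sum_{j=1}^N\beta_j^{(k)}=q^{(k)}$ for $k=1,\dots,P$; 4. the constant voltages are the negative mean strengths $$\phi^{(k)}=-\frac1N\sum_{j=1}^N\alpha_j^{(k)},\qquad k=1,\dots,P.$$
   Context: $\Omega^{(k)}$, $k=1,\dots,P$, are smooth bounded disjoint objects in $\mathbb{R}^3$ with boundaries $\partial\Omega^{(k)}$, and $\Omega=\bigcup_{k=1}^P\Omega^{(k)}$. For each $k$, $\mathbf{y}_j^{(k)}$, $j=1,\dots,N$, are proxy (source) points inside $\Omega^{(k)}$, and $\mathbf{x}_i^{(k)}$, $i=1,\dots,M$, are collocation points (nodes) on $\partial\Omega^{(k)}$; $N$ and $M$ do not depend on $k$. The Laplace fundamental solution is $G(\mathbf{x},\mathbf{y})=\frac{1}{4\pi\|\mathbf{x}-\mathbf{y}\|}$. The matrix $\mathbf{S}^{(kk')}\in\mathbb{R}^{M\times N}$ has entries $\mathbf{S}^{(kk')}_{ij}=G(\mathbf{x}_i^{(k)},\mathbf{y}_j^{(k')})$. $\mathbf{1}_N\in\mathbb{R}^N$ is the all-ones vector, $\mathbf{I}$ is the $N\times N$ identity, $\mathbf{L}=\frac1N\mathbf{1}_N\mathbf{1}_N^T$ is the $N\times N$ matrix with all entries $1/N$, and $\mathbf{L}_r\in\mathbb{R}^{M\times N}$ is the rectangular matrix with all entries $1/N$. The net charge of body $k$ for a potential $\sum_k\sum_j\beta_j^{(k)}G(\cdot,\mathbf{y}_j^{(k)})$ is the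 sum $\sum_{j=1}^N\beta_j^{(k)}$ of the source strengths in that body (by Gauss' law this equals $-\int_{\partial\Omega^{(k)}}\partial u/\partial n\,dS$, with $\mathbf n$ the outward unit normal). *)

theory Defs
  imports "HOL-Analysis.Analysis"
begin

definition partial_deriv :: "'a \<Rightarrow> ('a::euclidean_space \<Rightarrow> real) \<Rightarrow> 'a \<Rightarrow> real" where
  "partial_deriv b f = (\<lambda>x. frechet_derivative f (at x) b)"

text \<open>The class \<open>C\<^sup>k\<close> on a set \<open>S\<close>, which is meant to be open (only then is the Frechet
  derivative at a point determined by the values on \<open>S\<close>).\<close>

primrec Ck_on :: "nat \<Rightarrow> 'a set \<Rightarrow> ('a::euclidean_space \<Rightarrow> real) \<Rightarrow> bool" where
  "Ck_on 0 S f \<longleftrightarrow> continuous_on S f"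
| "Ck_on (Suc k) S f \<longleftrightarrow>
     (\<forall>x\<in>S. f differentiable (at x)) \<and> (\<forall>b\<in>Basis. Ck_on k S (partial_deriv b f))"

definition laplacian :: "('a::euclidean_space \<Rightarrow> real) \<Rightarrow> 'a \<Rightarrow> real" where
  "laplacian f x = (\<Sum>b\<in>Basis. partial_deriv b (partial_deriv b f) x)"

definition harmonic_on :: "'a set \<Rightarrow> ('a::euclidean_space \<Rightarrow> real) \<Rightarrow> bool" where
  "harmonic_on S f \<longleftrightarrow> open S \<and> Ck_on 2 S f \<and> (\<forall>x\<in>S. laplacian f x = 0)"

text \<open>A bounded open set with \<open>C\<^sup>\<infinity>\<close> boundary: near each boundary point the set is the negative
  side of a smooth defining function with nonvanishing gradient. Connectedness is not required.\<close>

definition smooth_bounded_open :: "'a::euclidean_space set \<Rightarrow> bool" where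
  "smooth_bounded_open D \<longleftrightarrow> open D \<and> bounded D \<and>
     (\<forall>p\<in>frontier D. \<exists>U \<rho>. open U \<and> p \<in> U \<and> (\<forall>k. Ck_on k U \<rho>) \<and>
        (\<forall>x\<in>U. \<exists>b\<in>Basis. partial_deriv b \<rho> x \<noteq> 0) \<and>
        D \<inter> U = {x \<in> U. \<rho> x < 0})"

text \<open>The index types \<open>'p\<close>, \<open>'m\<close>, \<open>'n\<close> enumerate the bodies, the collocation nodes per body and
  the proxy points per body, so \<open>P\<close>, \<open>M\<close>, \<open>N\<close> are \<open>CARD('p)\<close>, \<open>CARD('m)\<close>, \<open>CARD('n)\<close>.\<close>

definition fund_sol :: "real^3 \<Rightarrow> real^3 \<Rightarrow> real" where
  "fund_sol x y = 1 / (4 * pi * norm (x - y))"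

definition source_matrix ::
    "('p \<Rightarrow> 'm::finite \<Rightarrow> real^3) \<Rightarrow> ('p \<Rightarrow> 'n::finite \<Rightarrow> real^3) \<Rightarrow> 'p \<Rightarrow> 'p \<Rightarrow> real^'n^'m" where
  "source_matrix x y k k' = (\<chi> i j. fund_sol (x k i) (y k' j))"

definition mean_matrix :: "real^'n::finite^'n" where
  "mean_matrix = (\<chi> i j. 1 / real CARD('n))"

definition mean_matrix_rect :: "real^'n::finite^'m::finite" where
  "mean_matrix_rect = (\<chi> i j. 1 / real CARD('n))"

text \<open>In the next definition \<open>1\<close> is the all-ones vector.\<close>

definition uniform_strengths :: "('p \<Rightarrow> real) \<Rightarrow> 'p \<Rightarrow> real^'n::finite" where
  "uniform_strengths q k = (q k / real CARD('n)) *\<^sub>R 1"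

definition rhs_data ::
    "('p::finite \<Rightarrow> 'm::finite \<Rightarrow> real^3) \<Rightarrow> ('p \<Rightarrow> 'n::finite \<Rightarrow> real^3) \<Rightarrow> ('p \<Rightarrow> real) \<Rightarrow> 'p \<Rightarrow> real^'m"
  where
  "rhs_data x y q k = (\<Sum>k'\<in>UNIV. source_matrix x y k k' *v uniform_strengths q k')"

definition source_strengths ::
    "('p::finite \<Rightarrow> real) \<Rightarrow> real^'n::finite^'p \<Rightarrow> 'p \<Rightarrow> real^'n" where
  "source_strengths q \<alpha> k = (mat 1 - mean_matrix) *v (\<alpha> $ k) + uniform_strengths q k"

definition potential ::
    "('p::finite \<Rightarrow> 'n::finite \<Rightarrow> real^3) \<Rightarrow> ('p \<Rightarrow> real^'n) \<Rightarrow> real^3 \<Rightarrow> real" where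
  "potential y \<beta> z = (\<Sum>k\<in>UNIV. \<Sum>j\<in>UNIV. \<beta> k $ j * fund_sol z (y k j))"

definition net_charge :: "('p \<Rightarrow> real^'n::finite) \<Rightarrow> 'p \<Rightarrow> real" where
  "net_charge \<beta> k = (\<Sum>j\<in>UNIV. \<beta> k $ j)"

end

theory Submission
  imports Defs
begin

text \<open>Harmonicity is differentiation under the finite sum, no evaluation point being a source.
  In block row \<open>k\<close>, moving the data to the left combines \<open>I - L\<close> and the uniform strengths into
  \<open>\<beta>\<close>, so the row says that the potential at every node of body \<open>k\<close> is the matching entry of
  \<open>- L\<^sub>r \<alpha> k\<close>; these entries all equal the negative mean of \<open>\<alpha> k\<close>. The charges are right because
  \<open>I - L\<close> maps into the vectors of zero sum.\<close>

lemma partial_deriv_eq: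
  "(f has_derivative f') (at x) \<Longrightarrow> partial_deriv b f x = f' b"
  by (metis frechet_derivative_at partial_deriv_def)

text \<open>Reduces harmonicity to explicit formulas: \<open>f' x\<close> is the differential of
  \<open>f\<close>, and \<open>f'' b x c\<close> the derivative in direction \<open>c\<close> of its
  component along \<open>b\<close>, so the Laplacian is the trace of \<open>f''\<close>.\<close>

lemma harmonic_onI:
  fixes f :: "'a::euclidean_space \<Rightarrow> real"
  assumes S: "open S"
    and D1: "\<And>x. x \<in> S \<Longrightarrow> (f has_derivative f' x) (at x)"
    and D2: "\<And>b x. b \<in> Basis \<Longrightarrow> x \<in> S \<Longrightarrow> ((\<lambda>z. f' z b) has_derivative f'' b x) (at x)"
    and cont: "\<And>b c. continuous_on S (\<lambda>x. f'' b x c)"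
    and trace: "\<And>x. x \<in> S \<Longrightarrow> (\<Sum>b\<in>Basis. f'' b x b) = 0"
  shows "harmonic_on S f"
proof -
  have D2': "(partial_deriv b f has_derivative f'' b x) (at x)"
    if "b \<in> Basis" "x \<in> S" for b x
    \<comment> \<open>\<open>partial_deriv b f\<close> is known to agree with \<open>f'\<close> only
      on \<open>S\<close>; openness makes this agreement hold near \<open>x\<close>, which is what
      differentiating once more requires.\<close>
    using has_derivative_transform_within_open[OF D2[OF that] S \<open>x \<in> S\<close>]
    by (simp add: partial_deriv_eq[OF D1])
  have "continuous_on S (partial_deriv c (partial_deriv b f))" if "b \<in> Basis" for b c
    using cont[of b c] by (rule continuous_on_eq) (simp add: partial_deriv_eq[OF D2'[OF that]])
  then have "Ck_on 2 S f"
    using D1 D2' by (auto simp: numeral_2_eq_2 intro!: differentiableI)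
  moreover have "laplacian f x = 0" if "x \<in> S" for x
    using trace[OF that] by (simp add: laplacian_def partial_deriv_eq[OF D2'[OF _ that]])
  ultimately show ?thesis
    using S by (simp add: harmonic_on_def)
qed

text \<open>For x \<noteq> y, the gradient of \<open>fund_sol\<close> in its first argument, paired
  with \<open>h\<close>.\<close>

definition fund_sol_deriv :: "real^3 \<Rightarrow> real^3 \<Rightarrow> real^3 \<Rightarrow> real" where
  "fund_sol_deriv y x h = - ((x - y) \<bullet> h) / (4 * pi * norm (x - y) ^ 3)"

text \<open>For x \<noteq> y, the Hessian of \<open>fund_sol\<close> in its first argument, as a
  bilinear form in \<open>b\<close> and \<open>h\<close>.\<close>

definition fund_sol_deriv2 :: "real^3 \<Rightarrow> real^3 \<Rightarrow> real^3 \<Rightarrow> real^3 \<Rightarrow> real" where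
  "fund_sol_deriv2 y b x h =
     (3 * ((x - y) \<bullet> b) * ((x - y) \<bullet> h) / norm (x - y) ^ 5 - (b \<bullet> h) / norm (x - y) ^ 3) / (4 * pi)"

lemma has_derivative_norm_diff:
  fixes x y :: "'a::real_inner"
  assumes "x \<noteq> y"
  shows "((\<lambda>x. norm (x - y)) has_derivative (\<lambda>h. ((x - y) \<bullet> h) / norm (x - y))) (at x)"
proof -
  have "((\<lambda>x. norm (x - y)) has_derivative (\<lambda>h. (h - 0) \<bullet> sgn (x - y))) (at x)"
    using assms
    by (intro has_derivative_compose[OF _ has_derivative_norm, where f = "\<lambda>x. x - y"]
        has_derivative_diff has_derivative_ident has_derivative_const) simp
  then show ?thesis
    by (simp add: sgn_div_norm inner_commute divide_inverse mult.commute)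
qed

lemma has_derivative_fund_sol:
  assumes "x \<noteq> y"
  shows "((\<lambda>x. fund_sol x y) has_derivative fund_sol_deriv y x) (at x)"
proof -
  have r: "norm (x - y) \<noteq> 0" using assms by simp
  show ?thesis
    unfolding fund_sol_def
    by (rule has_derivative_eq_rhs[OF has_derivative_divide'[OF has_derivative_const
          has_derivative_mult_right[OF has_derivative_norm_diff[OF assms]]]])
      (use r in \<open>simp_all add: fund_sol_deriv_def fun_eq_iff divide_simps power2_eq_square power3_eq_cube\<close>)
qed

lemma has_derivative_fund_sol_deriv:
  assumes "x \<noteq> y"
  shows "((\<lambda>x. fund_sol_deriv y x b) has_derivative fund_sol_deriv2 y b x) (at x)"
proof -
  have r: "norm (x - y) \<noteq> 0" using assms by simp
  have num: "((\<lambda>x. - ((x - y) \<bullet> b)) has_derivative (\<lambda>h. - (b \<bullet> h))) (at x)"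
    by (auto intro!: derivative_eq_intros simp: inner_commute)
  have den: "((\<lambda>x. 4 * pi * norm (x - y) ^ 3) has_derivative
      (\<lambda>h. 4 * pi * (3 * norm (x - y) * ((x - y) \<bullet> h)))) (at x)"
    by (rule has_derivative_eq_rhs[OF has_derivative_mult_right[OF
          has_derivative_power[OF has_derivative_norm_diff[OF assms]]]])
      (use r in \<open>simp add: fun_eq_iff power2_eq_square\<close>)
  \<comment> \<open>The left side has exactly the shape produced by the quotient rule from
    \<open>num\<close> and \<open>den\<close>, with \<open>r\<close> the norm of x - y,
    \<open>A\<close> and \<open>B\<close> its inner products with \<open>h\<close> and
    \<open>b\<close>, \<open>C\<close> that of \<open>b\<close> with \<open>h\<close>, and
    \<open>p\<close> for pi. What remains is an identity between rational functions of
    reals.\<close>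
  have quotient: "(- C * (4 * p * r ^ 3) - - B * (4 * p * (3 * r * A))) / (4 * p * r ^ 3 * (4 * p * r ^ 3))
      = (3 * B * A / r ^ 5 - C / r ^ 3) / (4 * p)" if "r \<noteq> 0" "p \<noteq> 0" for A B C p r :: real
    using that by (simp add: field_simps eval_nat_numeral)
  show ?thesis
    unfolding fund_sol_deriv_def
  proof (rule has_derivative_eq_rhs[OF has_derivative_divide'[OF num den]])
    show "4 * pi * norm (x - y) ^ 3 \<noteq> 0"
      using r by simp
  qed (simp only: fun_eq_iff fund_sol_deriv2_def quotient[OF r pi_neq_zero] simp_thms)
qed

text \<open>With r the norm of x - y, the rank-one term has trace 3 r^2 / r^5, and the identity term
  has trace 3 / r^3 because the space has dimension three; the two cancel.\<close>

lemma trace_fund_sol_deriv2: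
  assumes "x \<noteq> y"
  shows "(\<Sum>b\<in>Basis. fund_sol_deriv2 y b x b) = 0"
proof -
  have cancel: "(3 * r ^ 2 / r ^ 5 - 3 / r ^ 3) / (4 * pi) = 0" if "r \<noteq> 0" for r :: real
    using that by (simp add: field_simps eval_nat_numeral)
  have "(\<Sum>b\<in>Basis. fund_sol_deriv2 y b x b) =
      (3 * (\<Sum>b\<in>Basis. ((x - y) \<bullet> b) * ((x - y) \<bullet> b)) / norm (x - y) ^ 5
        - (\<Sum>b\<in>(Basis :: (real^3) set). b \<bullet> b) / norm (x - y) ^ 3) / (4 * pi)"
    unfolding fund_sol_deriv2_def
    by (simp only: mult.assoc sum_subtractf flip: sum_divide_distrib sum_distrib_left)
  also have "(\<Sum>b\<in>Basis. ((x - y) \<bullet> b) * ((x - y) \<bullet> b)) = norm (x - y) ^ 2"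
    by (metis euclidean_inner power2_norm_eq_inner)
  also have "(\<Sum>b\<in>(Basis :: (real^3) set). b \<bullet> b) = 3"
    by simp
  also have "(3 * norm (x - y) ^ 2 / norm (x - y) ^ 5 - 3 / norm (x - y) ^ 3) / (4 * pi) = 0"
    by (rule cancel) (use assms in simp)
  finally show ?thesis .
qed

lemma continuous_on_fund_sol_deriv2:
  assumes "y \<notin> S"
  shows "continuous_on S (\<lambda>x. fund_sol_deriv2 y b x c)"
  unfolding fund_sol_deriv2_def
  using assms by (intro continuous_intros) auto

lemma harmonic_on_potential:
  assumes "open S" and "\<And>k j. y k j \<notin> S"
  shows "harmonic_on S (potential y \<beta>)"
proof (rule harmonic_onI)
  have ne: "x \<noteq> y k j" if "x \<in> S" for x k j
    using assms(2)[of k j] that by auto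
  show "(potential y \<beta> has_derivative (\<lambda>h. \<Sum>k\<in>UNIV. \<Sum>j\<in>UNIV. \<beta> k $ j * fund_sol_deriv (y k j) x h)) (at x)"
    if "x \<in> S" for x
    unfolding potential_def
    by (intro has_derivative_sum has_derivative_mult_right has_derivative_fund_sol ne that)
  show "((\<lambda>x. \<Sum>k\<in>UNIV. \<Sum>j\<in>UNIV. \<beta> k $ j * fund_sol_deriv (y k j) x b) has_derivative
      (\<lambda>h. \<Sum>k\<in>UNIV. \<Sum>j\<in>UNIV. \<beta> k $ j * fund_sol_deriv2 (y k j) b x h)) (at x)"
    if "x \<in> S" for x b
    by (intro has_derivative_sum has_derivative_mult_right has_derivative_fund_sol_deriv ne that)
  show "continuous_on S (\<lambda>x. \<Sum>k\<in>UNIV. \<Sum>j\<in>UNIV. \<beta> k $ j * fund_sol_deriv2 (y k j) b x c)" for b c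
    by (intro continuous_intros continuous_on_fund_sol_deriv2 assms)
  show "(\<Sum>b\<in>Basis. \<Sum>k\<in>UNIV. \<Sum>j\<in>UNIV. \<beta> k $ j * fund_sol_deriv2 (y k j) b x b) = 0"
    if "x \<in> S" for x
  proof -
    \<comment> \<open>Moving the sum over the basis innermost lets the trace vanish source by
      source.\<close>
    have "(\<Sum>b\<in>Basis. \<Sum>k\<in>UNIV. \<Sum>j\<in>UNIV. \<beta> k $ j * fund_sol_deriv2 (y k j) b x b) =
        (\<Sum>k\<in>UNIV. \<Sum>j\<in>UNIV. \<beta> k $ j * (\<Sum>b\<in>Basis. fund_sol_deriv2 (y k j) b x b))"
      unfolding sum_distrib_left
      by (subst sum.swap, intro sum.cong refl, rule sum.swap)
    then show ?thesis
      by (simp add: trace_fund_sol_deriv2[OF ne[OF that]])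
  qed
qed (rule assms)

text \<open>Solves a block row for its mean term: \<open>a\<close> is the diagonal block,
  \<open>c\<close> the \<open>mean_matrix_rect\<close> term, \<open>b\<close> the off-diagonal sum
  and \<open>d\<close> the data.\<close>

lemma add_eq_uminus_rearrange:
  fixes a b c d :: "'a::ab_group_add"
  shows "a + c + b = - d \<Longrightarrow> a + b + d = - c"
  by (simp add: eq_neg_iff_add_eq_0 ac_simps)

lemma potential_node:
  "potential y \<beta> (x k i) = (\<Sum>k'\<in>UNIV. source_matrix x y k k' *v \<beta> k') $ i"
  by (simp add: potential_def source_matrix_def matrix_vector_mult_def mult.commute)

lemma mean_matrix_rect_mult:
  "(mean_matrix_rect *v (a :: real^'n)) $ i = (1 / real CARD('n)) * (\<Sum>j\<in>UNIV. a $ j)"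
  by (simp add: mean_matrix_rect_def matrix_vector_mult_def sum_divide_distrib)

text \<open>Every entry of \<open>mean_matrix *v a\<close> is the mean of \<open>a\<close>, and N
  copies of the mean add up to the sum of \<open>a\<close>.\<close>

lemma sum_minus_mean_matrix_mult:
  fixes a :: "real^'n"
  shows "(\<Sum>j\<in>UNIV. ((mat 1 - mean_matrix) *v a) $ j) = 0"
proof -
  have "(\<Sum>j\<in>UNIV. ((mat 1 - mean_matrix) *v a) $ j)
      = (\<Sum>j\<in>UNIV. a $ j) - (\<Sum>j\<in>(UNIV::'n set). (\<Sum>i\<in>UNIV. a $ i) / real CARD('n))"
    \<comment> \<open>The instantiated definition unfolds only products with an entrywise given
      matrix, so \<open>mat 1 *v a\<close> can still simplify to \<open>a\<close>.\<close>
    by (simp add: matrix_vector_mult_diff_rdistrib sum_subtractf mean_matrix_def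
        matrix_vector_mult_def[of "\<chi> i j. _"] sum_divide_distrib)
  then show ?thesis by simp
qed

lemma net_charge_source_strengths: "net_charge (source_strengths q \<alpha>) k = q k"
  by (simp add: net_charge_def source_strengths_def sum.distrib sum_minus_mean_matrix_mult
      uniform_strengths_def)

theorem proposition1:
  fixes \<Omega> :: "'p::finite \<Rightarrow> (real^3) set"
    and x :: "'p \<Rightarrow> 'm::finite \<Rightarrow> real^3"
    and y :: "'p \<Rightarrow> 'n::finite \<Rightarrow> real^3"
    and q :: "'p \<Rightarrow> real"
    and \<alpha> :: "real^'n^'p"
  assumes "\<And>k. smooth_bounded_open (\<Omega> k)"
    and "disjoint_family \<Omega>"
    and "\<And>k j. y k j \<in> \<Omega> k"
    and "\<And>k i. x k i \<in> frontier (\<Omega> k)"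
    and "\<And>k. (source_matrix x y k k ** (mat 1 - mean_matrix) + mean_matrix_rect) *v (\<alpha> $ k)
           + (\<Sum>k'\<in>UNIV - {k}. (source_matrix x y k k' ** (mat 1 - mean_matrix)) *v (\<alpha> $ k'))
           = - rhs_data x y q k"
  shows "harmonic_on (- closure (\<Union>k. \<Omega> k)) (potential y (source_strengths q \<alpha>)) \<and>
    (\<forall>k. \<exists>\<phi>. \<forall>i. potential y (source_strengths q \<alpha>) (x k i) = \<phi>) \<and>
    (\<forall>k. net_charge (source_strengths q \<alpha>) k = q k) \<and>
    (\<forall>k \<phi>. (\<forall>i. potential y (source_strengths q \<alpha>) (x k i) = \<phi>) \<longrightarrow>
       \<phi> = - (1 / real CARD('n)) * (\<Sum>j\<in>UNIV. \<alpha> $ k $ j))"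
proof -
  let ?\<beta> = "source_strengths q \<alpha>" and ?m = "\<lambda>k. - (1 / real CARD('n)) * (\<Sum>j\<in>UNIV. \<alpha> $ k $ j)"
  have "y k j \<notin> - closure (\<Union>k. \<Omega> k)" for k j
    using assms(3)[of k j] closure_subset[of "\<Union>k. \<Omega> k"] by auto
  then have harmonic: "harmonic_on (- closure (\<Union>k. \<Omega> k)) (potential y ?\<beta>)"
    by (intro harmonic_on_potential) auto
  have nodes: "potential y ?\<beta> (x k i) = ?m k" for k i
  proof -
    let ?S = "source_matrix x y k" and ?J = "mat 1 - mean_matrix :: real^'n^'n"
    have "(\<Sum>k'\<in>UNIV. ?S k' *v ?\<beta> k')
        = (\<Sum>k'\<in>UNIV. (?S k' ** ?J) *v (\<alpha> $ k')) + rhs_data x y q k"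
      by (simp add: source_strengths_def rhs_data_def matrix_vector_right_distrib sum.distrib
          matrix_vector_mul_assoc)
    also have "(\<Sum>k'\<in>UNIV. (?S k' ** ?J) *v (\<alpha> $ k'))
        = (?S k ** ?J) *v (\<alpha> $ k) + (\<Sum>k'\<in>UNIV - {k}. (?S k' ** ?J) *v (\<alpha> $ k'))"
      by (rule sum.remove) auto
    also have "\<dots> + rhs_data x y q k = - (mean_matrix_rect *v (\<alpha> $ k))"
      by (rule add_eq_uminus_rearrange) (rule assms(5)[of k, unfolded matrix_vector_mult_add_rdistrib])
    finally show ?thesis
      by (simp add: potential_node mean_matrix_rect_mult)
  qed
  show ?thesis
    \<comment> \<open>\<open>nodes\<close> supplies the witness for the constant voltage. It also
      forces any constant \<phi> to equal the negative mean, since the node type is inhabited and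
      each body thus has a node at which to compare.\<close>
    using harmonic nodes net_charge_source_strengths by auto
qed

end
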